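(* The natural transformation $\rho:\mathrm{RV}\to\mathrm{M}$ between the functors $\mathrm{RV},\mathrm{M}:\mathbf{Prob}\to\mathbf{CMet}$, whose component at a probability space $\mathbf{\Omega}=(\Omega,\mathcal F,\mathbb P)$ is $$\rho_{\mathbf\Omega}:\mathrm{RV}(\mathbf\Omega)\to\mathrm{M}(\mathbf\Omega),\qquad f\mapsto\Big(A\mapsto\int_A f\,\mathrm d\mathbb P\Big),$$ is a natural isomorphism.
   Context: A "metric space" means a set with an extended pseudometric $d:X\times X\to[0,\infty]$ ($d(x,x)=0$, symmetric, triangle inequality). $\mathbf{CMet}$ is the category of complete such spaces and $1$-Lipschitz maps. $\mathbf{Prob}$ is the category of probability spaces and measure-preserving maps ($g:\mathbf\Omega_1\to\mathbf\Omega_2$ with $\mathbb P_1\circ g^{-1}=\mathbb P_2$). For a probability space $\mathbf\Omega=(\Omega,\mathcal F,\mathbb P)$: $\mathrm{RV}(\mathbf\Omega)$ is the set of $\mathbb P$-integrable measurable functions $\Omega\to[0,\infty)$ modulo $\mathbb P$-almost sure equality, with metric $d_{L^1}(f,g)=\int|f-g|\,\mathrm d\mathbb P$. $\mathrm M(\mathbf\Omega)$ is the set of finite measures $\mu$ on $(\Omega,\mathcal F)$ with $\mu\ll\mathbb P$, with the total variation metric $d_{\mathrm{TV}}(\mu,\nu)=\sup\{\sum_{n=1}^\infty|\mu(A_n)-\nu(A_n)| : (A_n)_{n\ge1}\text{ a measurable partition of }\Omega\}$. On a measure-preserving map $g:\mathbf\Omega_1\to\mathbf\Omega_2$, the functors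 act by $\mathrm{M}(g)(\mu)=\mu\circ g^{-1}$ and $\mathrm{RV}(g)(f)=\mathbb E[f\mid g]$, where $\mathbb E[f\mid g]\in\mathrm{RV}(\mathbf\Omega_2)$ is the unique element satisfying $\int_{g^{-1}(B)}f\,\mathrm d\mathbb P_1=\int_B\mathbb E[f\mid g]\,\mathrm d\mathbb P_2$ for all measurable $B\subseteq\Omega_2$. *)

theory Defs
  imports "HOL-Probability.Probability"
begin

section \<open>Categories, functors, natural transformations\<close>

text \<open>Arrows are indexed by their source and target: the sets \<open>Hom C A B\<close> need not be disjoint,
  and \<open>Comp C A B D g f\<close> is the composite of \<open>f : A \<rightarrow> B\<close> and \<open>g : B \<rightarrow> D\<close>.\<close>

record ('o, 'm) cat =
  Obj :: "'o set"
  Hom :: "'o \<Rightarrow> 'o \<Rightarrow> 'm set"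
  Ident :: "'o \<Rightarrow> 'm"
  Comp :: "'o \<Rightarrow> 'o \<Rightarrow> 'o \<Rightarrow> 'm \<Rightarrow> 'm \<Rightarrow> 'm"

record ('o, 'm, 'p, 'n) cat_functor =
  on_obj :: "'o \<Rightarrow> 'p"
  on_hom :: "'o \<Rightarrow> 'o \<Rightarrow> 'm \<Rightarrow> 'n"

locale category =
  fixes C :: "('o, 'm) cat"
  assumes ident_in_hom: "A \<in> Obj C \<Longrightarrow> Ident C A \<in> Hom C A A"
    and comp_in_hom: "\<lbrakk>A \<in> Obj C; B \<in> Obj C; D \<in> Obj C; f \<in> Hom C A B; g \<in> Hom C B D\<rbrakk>
      \<Longrightarrow> Comp C A B D g f \<in> Hom C A D"
    and comp_ident: "\<lbrakk>A \<in> Obj C; B \<in> Obj C; f \<in> Hom C A B\<rbrakk>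
      \<Longrightarrow> Comp C A A B f (Ident C A) = f"
    and ident_comp: "\<lbrakk>A \<in> Obj C; B \<in> Obj C; f \<in> Hom C A B\<rbrakk>
      \<Longrightarrow> Comp C A B B (Ident C B) f = f"
    and comp_assoc: "\<lbrakk>A \<in> Obj C; B \<in> Obj C; D \<in> Obj C; E \<in> Obj C;
        f \<in> Hom C A B; g \<in> Hom C B D; h \<in> Hom C D E\<rbrakk>
      \<Longrightarrow> Comp C A D E h (Comp C A B D g f) = Comp C A B E (Comp C B D E h g) f"

definition isomorphism :: "('o, 'm) cat \<Rightarrow> 'o \<Rightarrow> 'o \<Rightarrow> 'm \<Rightarrow> bool" where
  "isomorphism C A B f \<longleftrightarrow> f \<in> Hom C A B \<and>
    (\<exists>g \<in> Hom C B A. Comp C A B A g f = Ident C A \<and> Comp C B A B f g = Ident C B)"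

locale functor_between = dom: category C + cod: category D
  for C :: "('o, 'm) cat" and D :: "('p, 'n) cat" +
  fixes F :: "('o, 'm, 'p, 'n) cat_functor"
  assumes on_obj_in: "A \<in> Obj C \<Longrightarrow> on_obj F A \<in> Obj D"
    and on_hom_in: "\<lbrakk>A \<in> Obj C; B \<in> Obj C; f \<in> Hom C A B\<rbrakk>
      \<Longrightarrow> on_hom F A B f \<in> Hom D (on_obj F A) (on_obj F B)"
    and on_hom_ident: "A \<in> Obj C \<Longrightarrow> on_hom F A A (Ident C A) = Ident D (on_obj F A)"
    and on_hom_comp: "\<lbrakk>A \<in> Obj C; B \<in> Obj C; E \<in> Obj C; f \<in> Hom C A B; g \<in> Hom C B E\<rbrakk>
      \<Longrightarrow> on_hom F A E (Comp C A B E g f) =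
        Comp D (on_obj F A) (on_obj F B) (on_obj F E) (on_hom F B E g) (on_hom F A B f)"

locale natural_transformation = src: functor_between C D F + tgt: functor_between C D G
  for C :: "('o, 'm) cat" and D :: "('p, 'n) cat"
    and F G :: "('o, 'm, 'p, 'n) cat_functor" +
  fixes \<eta> :: "'o \<Rightarrow> 'n"
  assumes component_in: "A \<in> Obj C \<Longrightarrow> \<eta> A \<in> Hom D (on_obj F A) (on_obj G A)"
    and naturality: "\<lbrakk>A \<in> Obj C; B \<in> Obj C; f \<in> Hom C A B\<rbrakk>
      \<Longrightarrow> Comp D (on_obj F A) (on_obj F B) (on_obj G B) (\<eta> B) (on_hom F A B f) =
        Comp D (on_obj F A) (on_obj G A) (on_obj G B) (on_hom G A B f) (\<eta> A)"

locale natural_isomorphism = natural_transformation C D F G \<eta>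
  for C :: "('o, 'm) cat" and D :: "('p, 'n) cat"
    and F G :: "('o, 'm, 'p, 'n) cat_functor" and \<eta> :: "'o \<Rightarrow> 'n" +
  assumes component_iso: "A \<in> Obj C \<Longrightarrow> isomorphism D (on_obj F A) (on_obj G A) (\<eta> A)"


section \<open>Complete extended pseudometric spaces\<close>

record 'p emspace =
  points :: "'p set"
  edist :: "'p \<Rightarrow> 'p \<Rightarrow> ennreal"

definition ext_pseudometric_space :: "'p emspace \<Rightarrow> bool" where
  "ext_pseudometric_space X \<longleftrightarrow>
    (\<forall>x \<in> points X. edist X x x = 0) \<and>
    (\<forall>x \<in> points X. \<forall>y \<in> points X. edist X x y = edist X y x) \<and>
    (\<forall>x \<in> points X. \<forall>y \<in> points X. \<forall>z \<in> points X.
       edist X x z \<le> edist X x y + edist X y z)"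

definition em_Cauchy :: "'p emspace \<Rightarrow> (nat \<Rightarrow> 'p) \<Rightarrow> bool" where
  "em_Cauchy X s \<longleftrightarrow> (\<forall>e>0. \<exists>N. \<forall>m\<ge>N. \<forall>n\<ge>N. edist X (s m) (s n) < e)"

definition em_complete :: "'p emspace \<Rightarrow> bool" where
  "em_complete X \<longleftrightarrow> (\<forall>s. range s \<subseteq> points X \<and> em_Cauchy X s \<longrightarrow>
    (\<exists>x \<in> points X. (\<lambda>n. edist X (s n) x) \<longlonglongrightarrow> 0))"

definition CMet :: "('p emspace, 'p \<Rightarrow> 'p) cat" where
  "CMet = \<lparr>
     Obj = {X. ext_pseudometric_space X \<and> em_complete X},
     Hom = (\<lambda>X Y. {f \<in> points X \<rightarrow>\<^sub>E points Y.
       \<forall>x \<in> points X. \<forall>y \<in> points X. edist Y (f x) (f y) \<le> edist X x y}),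
     Ident = (\<lambda>X. restrict (\<lambda>x. x) (points X)),
     Comp = (\<lambda>X Y Z g f. compose (points X) g f)\<rparr>"


section \<open>Probability spaces\<close>

text \<open>The type variable \<open>'a\<close> plays the role of a universe: the objects are all probability spaces
  whose sample space is any subset of \<open>'a\<close>.  Maps are made extensional, so that two arrows are
  equal iff they agree on the sample space.\<close>

definition Prob :: "('a measure, 'a \<Rightarrow> 'a) cat" where
  "Prob = \<lparr>
     Obj = {\<Omega>. prob_space \<Omega>},
     Hom = (\<lambda>\<Omega>1 \<Omega>2. {g \<in> extensional (space \<Omega>1). g \<in> measurable \<Omega>1 \<Omega>2 \<and> distr \<Omega>1 \<Omega>2 g = \<Omega>2}),
     Ident = (\<lambda>\<Omega>. restrict (\<lambda>x. x) (space \<Omega>)),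
     Comp = (\<lambda>\<Omega>1 \<Omega>2 \<Omega>3 g f. compose (space \<Omega>1) g f)\<rparr>"


section \<open>Integrable random variables\<close>

definition nonneg_integrable :: "'a measure \<Rightarrow> ('a \<Rightarrow> real) set" where
  "nonneg_integrable \<Omega> = {f. integrable \<Omega> f \<and> (\<forall>\<omega> \<in> space \<Omega>. 0 \<le> f \<omega>)}"

text \<open>Almost sure equality does not see values outside \<open>space \<Omega>\<close>, so the classes below
  correspond to classes of functions defined on \<open>space \<Omega>\<close> only.\<close>

definition as_equal :: "'a measure \<Rightarrow> (('a \<Rightarrow> real) \<times> ('a \<Rightarrow> real)) set" where
  "as_equal \<Omega> = {(f, h). f \<in> nonneg_integrable \<Omega> \<and> h \<in> nonneg_integrable \<Omega> \<and>
     (AE \<omega> in \<Omega>. f \<omega> = h \<omega>)}"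

text \<open>A representative of a class; everything built on it is independent of the choice.\<close>

definition rep :: "('a \<Rightarrow> real) set \<Rightarrow> 'a \<Rightarrow> real" where
  "rep X = (SOME f. f \<in> X)"

definition RV_space :: "'a measure \<Rightarrow> ('a \<Rightarrow> real) set emspace" where
  "RV_space \<Omega> = \<lparr>
     points = nonneg_integrable \<Omega> // as_equal \<Omega>,
     edist = (\<lambda>X Y. \<integral>\<^sup>+\<omega>. ennreal \<bar>rep X \<omega> - rep Y \<omega>\<bar> \<partial>\<Omega>)\<rparr>"

definition cond_exp_along ::
  "'a measure \<Rightarrow> 'b measure \<Rightarrow> ('a \<Rightarrow> 'b) \<Rightarrow> ('a \<Rightarrow> real) set \<Rightarrow> ('b \<Rightarrow> real) set" where
  "cond_exp_along \<Omega>1 \<Omega>2 g X = (THE Y. Y \<in> points (RV_space \<Omega>2) \<and>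
     (\<forall>B \<in> sets \<Omega>2. (LINT \<omega>:(g -` B \<inter> space \<Omega>1)|\<Omega>1. rep X \<omega>) = (LINT \<omega>:B|\<Omega>2. rep Y \<omega>)))"


section \<open>Absolutely continuous finite measures\<close>

definition total_variation_dist :: "'a measure \<Rightarrow> 'a measure \<Rightarrow> 'a measure \<Rightarrow> ennreal" where
  "total_variation_dist \<Omega> \<mu> \<nu> =
     (SUP A \<in> {A :: nat \<Rightarrow> 'a set. range A \<subseteq> sets \<Omega> \<and> disjoint_family A \<and> (\<Union>n. A n) = space \<Omega>}.
        \<Sum>n. ennreal \<bar>measure \<mu> (A n) - measure \<nu> (A n)\<bar>)"

definition M_space :: "'a measure \<Rightarrow> 'a measure emspace" where
  "M_space \<Omega> = \<lparr>
     points = {\<mu>. sets \<mu> = sets \<Omega> \<and> finite_measure \<mu> \<and> absolutely_continuous \<Omega> \<mu>},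
     edist = total_variation_dist \<Omega>\<rparr>"


section \<open>The functors and the transformation\<close>

text \<open>Both functors must land in the same category.  Since the points of \<^term>\<open>RV_space \<Omega>\<close> and
  \<^term>\<open>M_space \<Omega>\<close> have different types, both are embedded in the disjoint sum of these types:
  \<open>transport i X\<close> is the space \<open>X\<close> with its points renamed along the injection \<open>i\<close>.\<close>

type_synonym 'a point = "('a \<Rightarrow> real) set + 'a measure"

definition transport :: "('p \<Rightarrow> 'q) \<Rightarrow> 'p emspace \<Rightarrow> 'q emspace" where
  "transport i X = \<lparr>points = i ` points X, edist = (\<lambda>x y. edist X (inv i x) (inv i y))\<rparr>"

definition transport_map ::
  "('p \<Rightarrow> 'u) \<Rightarrow> ('q \<Rightarrow> 'u) \<Rightarrow> 'p emspace \<Rightarrow> ('p \<Rightarrow> 'q) \<Rightarrow> 'u \<Rightarrow> 'u" where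
  "transport_map i j X f = restrict (\<lambda>x. j (f (inv i x))) (i ` points X)"

definition RV_functor :: "('a measure, 'a \<Rightarrow> 'a, 'a point emspace, 'a point \<Rightarrow> 'a point) cat_functor" where
  "RV_functor = \<lparr>
     on_obj = (\<lambda>\<Omega>. transport Inl (RV_space \<Omega>)),
     on_hom = (\<lambda>\<Omega>1 \<Omega>2 g. transport_map Inl Inl (RV_space \<Omega>1) (cond_exp_along \<Omega>1 \<Omega>2 g))\<rparr>"

definition M_functor :: "('a measure, 'a \<Rightarrow> 'a, 'a point emspace, 'a point \<Rightarrow> 'a point) cat_functor" where
  "M_functor = \<lparr>
     on_obj = (\<lambda>\<Omega>. transport Inr (M_space \<Omega>)),
     on_hom = (\<lambda>\<Omega>1 \<Omega>2 g. transport_map Inr Inr (M_space \<Omega>1) (\<lambda>\<mu>. distr \<mu> \<Omega>2 g))\<rparr>"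

definition \<rho> :: "'a measure \<Rightarrow> 'a point \<Rightarrow> 'a point" where
  "\<rho> \<Omega> = transport_map Inl Inr (RV_space \<Omega>) (\<lambda>X. density \<Omega> (\<lambda>\<omega>. ennreal (rep X \<omega>)))"

end

theory Submission
  imports Defs
begin

text \<open>
  Let \<open>\<iota>\<close> send (the class of) \<open>f\<close> to the measure with density \<open>f\<close>.  The theorem rests on three facts.

  First, \<open>\<iota>\<close> is an isometry of \<open>RV(\<Omega>)\<close> onto \<open>M(\<Omega>)\<close>.  For a measurable partition \<open>(A\<^sub>n)\<close> the sum of the
  numbers \<open>\<bar>\<integral>\<^bsub>A\<^sub>n\<^esub> (f - h)\<bar>\<close> is at most \<open>\<integral> \<bar>f - h\<bar>\<close>, and the partition into \<open>{f \<ge> h}\<close> and \<open>{f < h}\<close>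
  attains this value; so total variation distance is \<open>L\<^sup>1\<close> distance of densities
  (\<open>total_variation_dist_density\<close>).  Surjectivity is the Radon-Nikodym theorem, and injectivity holds
  because functions at \<open>L\<^sup>1\<close> distance zero agree almost surely.

  Second, \<open>RV(\<Omega>)\<close> is complete: this is completeness of \<open>L\<^sup>1\<close> (\<open>L1_Cauchy_converges\<close>).  Completeness
  of \<open>M(\<Omega>)\<close> then follows along the isometry.

  Third, the equation that defines \<open>E[f | g]\<close> says exactly that \<open>\<iota>\<close> sends \<open>E[f | g]\<close> to the image of
  \<open>\<iota>(f)\<close> under \<open>g\<close> (\<open>cond_exp_along_iff\<close>).  As \<open>\<iota>\<close> is a bijection, conditional expectations exist and
  are unique, and the naturality square commutes.

  Pushforward of measures is visibly functorial and contractive.  That \<open>RV\<close> is a functor needs no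
  computation with conditional expectations: its action is that of \<open>M\<close> conjugated by isomorphisms, and
  \<open>natural_isomorphismI\<close> derives the functor laws for \<open>RV\<close> from those for \<open>M\<close>.
\<close>

section \<open>Completeness of the space of integrable functions\<close>

text \<open>The Riesz-Fischer argument: a subsequence whose consecutive distances are bounded by a geometric
  series converges almost everywhere, because the sum of its increments has finite integral.  Fatou's
  lemma turns the pointwise limit into a limit in \<open>L\<^sup>1\<close>.\<close>

lemma L1_Cauchy_converges:
  fixes f :: "nat \<Rightarrow> 'a \<Rightarrow> real"
  assumes int: "\<And>n. integrable M (f n)"
    and Cauchy: "\<And>e :: ennreal. e > 0 \<Longrightarrow>
      \<exists>N. \<forall>m\<ge>N. \<forall>n\<ge>N. (\<integral>\<^sup>+x. ennreal \<bar>f m x - f n x\<bar> \<partial>M) < e"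
  obtains g where "integrable M g" "(\<lambda>n. \<integral>\<^sup>+x. ennreal \<bar>f n x - g x\<bar> \<partial>M) \<longlonglongrightarrow> 0"
proof -
  define d where "d m h = (\<integral>\<^sup>+x. ennreal \<bar>f m x - h x\<bar> \<partial>M)" for m h
  have [measurable]: "f n \<in> borel_measurable M" for n
    using int by auto
  have "\<exists>N. \<forall>m\<ge>N. \<forall>n\<ge>N. d m (f n) < ennreal ((1/2)^k)" for k
    unfolding d_def by (rule Cauchy) simp
  then obtain N where N: "\<And>k m n. m \<ge> N k \<Longrightarrow> n \<ge> N k \<Longrightarrow> d m (f n) < ennreal ((1/2)^k)"
    by metis
  \<comment> \<open>The sum of all \<open>N i\<close> up to \<open>k\<close> dominates \<open>N k\<close> and makes \<open>r\<close> monotone, so \<open>r k\<close> and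
    \<open>r (Suc k)\<close> both exceed \<open>N k\<close>; the summand \<open>k\<close> makes \<open>r\<close> tend to infinity.\<close>
  define r where "r k = k + (\<Sum>i\<le>k. N i)" for k
  have r_ge: "r k \<ge> k" for k
    by (simp add: r_def)
  have r_N: "r k \<ge> N k" "r (Suc k) \<ge> N k" for k
    using member_le_sum[of k "{..k}" N] by (simp_all add: r_def)
  have "(\<integral>\<^sup>+x. (\<Sum>k. ennreal \<bar>f (r (Suc k)) x - f (r k) x\<bar>) \<partial>M) = (\<Sum>k. d (r (Suc k)) (f (r k)))"
    unfolding d_def by (rule nn_integral_suminf) simp
  also have "\<dots> \<le> (\<Sum>k. ennreal ((1/2)^k))"
    by (intro suminf_le less_imp_le N r_N) auto
  also have "\<dots> = ennreal (\<Sum>k. (1/2)^k)"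
    by (intro suminf_ennreal2 summable_geometric) auto
  finally have "(\<integral>\<^sup>+x. (\<Sum>k. ennreal \<bar>f (r (Suc k)) x - f (r k) x\<bar>) \<partial>M) \<noteq> \<infinity>"
    by (auto simp: top_unique)
  then have "AE x in M. (\<Sum>k. ennreal \<bar>f (r (Suc k)) x - f (r k) x\<bar>) \<noteq> \<infinity>"
    by (intro nn_integral_noteq_infinite) auto
  then have conv: "AE x in M. (\<lambda>k. f (r k) x) \<longlonglongrightarrow> lim (\<lambda>k. f (r k) x)"
  proof (rule AE_mp, intro AE_I2 impI)
    fix x assume "(\<Sum>k. ennreal \<bar>f (r (Suc k)) x - f (r k) x\<bar>) \<noteq> \<infinity>"
    then have "summable (\<lambda>k. \<bar>f (r (Suc k)) x - f (r k) x\<bar>)"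
      by (intro summable_suminf_not_top) auto
    then have "summable (\<lambda>k. f (r (Suc k)) x - f (r k) x)"
      by (rule summable_rabs_cancel)
    then have "convergent (\<lambda>n. f (r n) x - f (r 0) x)"
      by (simp add: summable_iff_convergent sum_lessThan_telescope[of "\<lambda>k. f (r k) x"])
    then have "convergent (\<lambda>n. f (r n) x)"
      by (simp add: convergent_diff_const_right_iff)
    then show "(\<lambda>k. f (r k) x) \<longlonglongrightarrow> lim (\<lambda>k. f (r k) x)"
      by (simp add: convergent_LIMSEQ_iff)
  qed
  define g where "g x = lim (\<lambda>k. f (r k) x)" for x
  have [measurable]: "g \<in> borel_measurable M"
    unfolding g_def by (rule borel_measurable_lim_metric) simp
  \<comment> \<open>Fatou's lemma, applied to \<open>k \<mapsto> \<bar>f n - f (r k)\<bar>\<close>.\<close>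
  have close: "\<exists>K. \<forall>n\<ge>K. d n g \<le> e" if "e > 0" for e
  proof -
    obtain K where K: "\<And>m n. m \<ge> K \<Longrightarrow> n \<ge> K \<Longrightarrow> d m (f n) < e"
      using Cauchy[OF \<open>e > 0\<close>] unfolding d_def by blast
    have "d n g \<le> e" if n: "n \<ge> K" for n
    proof -
      have "d n g = (\<integral>\<^sup>+x. liminf (\<lambda>k. ennreal \<bar>f n x - f (r k) x\<bar>) \<partial>M)"
        unfolding d_def
      proof (rule nn_integral_cong_AE, rule AE_mp[OF conv], intro AE_I2 impI)
        fix x assume "(\<lambda>k. f (r k) x) \<longlonglongrightarrow> lim (\<lambda>k. f (r k) x)"
        then have "(\<lambda>k. ennreal \<bar>f n x - f (r k) x\<bar>) \<longlonglongrightarrow> ennreal \<bar>f n x - g x\<bar>"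
          unfolding g_def by (intro tendsto_intros)
        then show "ennreal \<bar>f n x - g x\<bar> = liminf (\<lambda>k. ennreal \<bar>f n x - f (r k) x\<bar>)"
          by (intro lim_imp_Liminf[symmetric] trivial_limit_sequentially)
      qed
      also have "\<dots> \<le> liminf (\<lambda>k. d n (f (r k)))"
        unfolding d_def by (rule nn_integral_liminf) simp
      also have "\<dots> \<le> e"
      proof (rule order_trans[OF Liminf_le_Limsup])
        show "limsup (\<lambda>k. d n (f (r k))) \<le> e"
          using K[OF n] r_ge
          by (intro Limsup_bounded eventually_sequentiallyI[of K]) (meson less_imp_le order_trans)
      qed simp
      finally show ?thesis .
    qed
    then show ?thesis by blast
  qed
  obtain n where n: "d n g \<le> 1"
    using close[of 1] by auto
  have "integrable M (\<lambda>x. f n x - g x)"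
    by (intro integrableI_bounded) (use n in \<open>auto simp: d_def intro: le_less_trans\<close>)
  from Bochner_Integration.integrable_diff[OF int[of n] this] have "integrable M g"
    by simp
  moreover have "(\<lambda>n. d n g) \<longlonglongrightarrow> 0"
  proof (rule order_tendstoI)
    fix e :: ennreal assume "0 < e"
    then obtain e' where e': "0 < e'" "e' < e"
      using dense by blast
    show "eventually (\<lambda>n. d n g < e) sequentially"
      using close[OF e'(1)] e'(2) unfolding eventually_sequentially by (meson le_less_trans)
  qed simp
  ultimately show thesis
    using that unfolding d_def by blast
qed

section \<open>Isometries and the two categories\<close>

text \<open>Distances may vanish between distinct points, so preserving them does not imply injectivity;
  bijectivity is therefore part of the definition.\<close>
definition isometry :: "'p emspace \<Rightarrow> 'q emspace \<Rightarrow> ('p \<Rightarrow> 'q) \<Rightarrow> bool" where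
  "isometry X Y \<phi> \<longleftrightarrow> bij_betw \<phi> (points X) (points Y) \<and>
    (\<forall>x \<in> points X. \<forall>y \<in> points X. edist Y (\<phi> x) (\<phi> y) = edist X x y)"

lemma isometry_in: "isometry X Y \<phi> \<Longrightarrow> x \<in> points X \<Longrightarrow> \<phi> x \<in> points Y"
  by (auto simp: isometry_def bij_betw_def)

lemma isometry_edist:
  "isometry X Y \<phi> \<Longrightarrow> x \<in> points X \<Longrightarrow> y \<in> points X \<Longrightarrow> edist Y (\<phi> x) (\<phi> y) = edist X x y"
  by (auto simp: isometry_def)

lemma isometry_inv_into:
  assumes "isometry X Y \<phi>"
  shows "isometry Y X (inv_into (points X) \<phi>)"
proof -
  have b: "bij_betw \<phi> (points X) (points Y)"
    using assms by (simp add: isometry_def)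
  have "edist X (inv_into (points X) \<phi> u) (inv_into (points X) \<phi> v) = edist Y u v"
    if "u \<in> points Y" "v \<in> points Y" for u v
    using isometry_edist[OF assms, of "inv_into (points X) \<phi> u" "inv_into (points X) \<phi> v"] that b
    by (simp add: bij_betw_inv_into_right inv_into_into bij_betw_def f_inv_into_f)
  then show ?thesis
    using b by (simp add: isometry_def bij_betw_inv_into)
qed

lemma isometry_comp:
  "isometry X Y \<phi> \<Longrightarrow> isometry Y Z \<psi> \<Longrightarrow> isometry X Z (\<lambda>x. \<psi> (\<phi> x))"
  using bij_betw_trans[of \<phi> "points X" "points Y" \<psi> "points Z"] bij_betw_apply[of \<phi> "points X" "points Y"]
  by (simp add: isometry_def o_def)

lemma isometry_cong:
  "(\<And>x. x \<in> points X \<Longrightarrow> \<phi> x = \<psi> x) \<Longrightarrow> isometry X Y \<phi> \<longleftrightarrow> isometry X Y \<psi>"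
  by (simp add: isometry_def cong: bij_betw_cong)

lemma isometry_transport: "inj i \<Longrightarrow> isometry X (transport i X) i"
  by (auto simp: isometry_def transport_def bij_betw_def intro: inj_on_subset)

lemma isometry_transport_map:
  assumes "inj i" "inj j" "isometry X Y \<phi>"
  shows "isometry (transport i X) (transport j Y) (transport_map i j X \<phi>)"
proof -
  have "isometry (transport i X) (transport j Y) (\<lambda>u. j (\<phi> (inv_into (points X) i u)))"
    using isometry_comp[OF isometry_comp[OF isometry_inv_into[OF isometry_transport[OF assms(1)]] assms(3)]
        isometry_transport[OF assms(2)]] .
  moreover have "inv_into (points X) i u = inv i u" if "u \<in> i ` points X" for u
    using that assms(1) by (auto simp: inv_into_f_f inj_on_subset)
  ultimately show ?thesis
    by (subst isometry_cong) (auto simp: transport_map_def transport_def)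
qed

text \<open>Pulling a Cauchy sequence of \<open>Y\<close> back to \<open>X\<close> and pushing a limit forward shows that completeness
  is invariant under isometries.  This is the only source of completeness for spaces of measures.\<close>
lemma isometry_Obj_CMet:
  assumes iso: "isometry X Y \<phi>" and X: "X \<in> Obj CMet"
  shows "Y \<in> Obj CMet"
proof -
  let ?\<psi> = "inv_into (points X) \<phi>"
  note inv = isometry_inv_into[OF iso]
  have "ext_pseudometric_space Y"
    using X unfolding CMet_def ext_pseudometric_space_def
    by (simp add: isometry_edist[OF inv, symmetric] isometry_in[OF inv])
  moreover have "em_complete Y"
    unfolding em_complete_def
  proof (intro allI impI)
    fix s assume s: "range s \<subseteq> points Y \<and> em_Cauchy Y s"
    then have sY: "s n \<in> points Y" for n
      by auto
    have "em_Cauchy X (\<lambda>n. ?\<psi> (s n))"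
      using s by (simp add: em_Cauchy_def isometry_edist[OF inv] sY)
    then obtain x where x: "x \<in> points X" "(\<lambda>n. edist X (?\<psi> (s n)) x) \<longlonglongrightarrow> 0"
      using X isometry_in[OF inv sY] unfolding CMet_def em_complete_def by force
    have "edist X (?\<psi> (s n)) x = edist Y (s n) (\<phi> x)" for n
      using isometry_edist[OF iso isometry_in[OF inv sY[of n]] x(1)] iso sY[of n]
      by (simp add: isometry_def bij_betw_inv_into_right[of \<phi> "points X" "points Y"])
    then show "\<exists>y\<in>points Y. (\<lambda>n. edist Y (s n) y) \<longlonglongrightarrow> 0"
      using x isometry_in[OF iso] by auto
  qed
  ultimately show ?thesis
    by (simp add: CMet_def)
qed

lemma isometry_isomorphism:
  assumes iso: "isometry X Y \<phi>" and ext: "\<phi> \<in> extensional (points X)"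
  shows "isomorphism CMet X Y \<phi>"
proof -
  let ?\<psi> = "restrict (inv_into (points X) \<phi>) (points Y)"
  note inv = isometry_inv_into[OF iso]
  have b: "bij_betw \<phi> (points X) (points Y)"
    using iso by (simp add: isometry_def)
  have "\<phi> \<in> Hom CMet X Y"
    using ext by (auto simp: CMet_def PiE_def isometry_in[OF iso] isometry_edist[OF iso])
  moreover have "?\<psi> \<in> Hom CMet Y X"
    by (auto simp: CMet_def isometry_in[OF inv] isometry_edist[OF inv])
  moreover have "Comp CMet X Y X ?\<psi> \<phi> = Ident CMet X"
    using b by (auto simp: CMet_def compose_def fun_eq_iff restrict_def isometry_in[OF iso]
        bij_betw_inv_into_left)
  moreover have "Comp CMet Y X Y \<phi> ?\<psi> = Ident CMet Y"
    using b by (auto simp: CMet_def compose_def fun_eq_iff restrict_def bij_betw_inv_into_right)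
  ultimately show ?thesis
    by (auto simp: isomorphism_def)
qed

lemma category_CMet: "category (CMet :: ('p emspace, 'p \<Rightarrow> 'p) cat)"
proof
  fix A B D :: "'p emspace" and f g
  assume "f \<in> Hom CMet A B" "g \<in> Hom CMet B D"
  then show "Comp CMet A B D g f \<in> Hom CMet A D"
    by (auto simp: CMet_def compose_def PiE_iff) (meson order_trans)
next
  fix A B D E :: "'p emspace" and f g h
  assume "f \<in> Hom CMet A B" "g \<in> Hom CMet B D" "h \<in> Hom CMet D E"
  then show "Comp CMet A D E h (Comp CMet A B D g f) = Comp CMet A B E (Comp CMet B D E h g) f"
    by (auto simp: CMet_def compose_def fun_eq_iff PiE_iff)
qed (auto simp: CMet_def compose_def fun_eq_iff PiE_iff extensional_def)

lemma category_Prob: "category (Prob :: ('a measure, 'a \<Rightarrow> 'a) cat)"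
proof
  fix A :: "'a measure"
  have "distr A A (restrict (\<lambda>x. x) (space A)) = distr A A (\<lambda>x. x)"
    by (rule distr_cong) auto
  moreover have "restrict (\<lambda>x. x) (space A) \<in> measurable A A"
    by (subst measurable_cong[where g="\<lambda>x. x"]) auto
  ultimately show "Ident Prob A \<in> Hom Prob A A"
    by (simp add: Prob_def distr_id)
next
  fix A B D :: "'a measure" and f g
  assume f: "f \<in> Hom Prob A B" and g: "g \<in> Hom Prob B D"
  then have [measurable]: "f \<in> measurable A B" "g \<in> measurable B D"
    by (auto simp: Prob_def)
  have c: "compose (space A) g f \<in> measurable A D"
    unfolding compose_def restrict_def by (subst measurable_cong[where g="\<lambda>x. g (f x)"]) auto
  have "distr A D (compose (space A) g f) = distr A D (g \<circ> f)"
    by (rule distr_cong) (auto simp: compose_def)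
  also have "\<dots> = distr (distr A B f) D g"
    by (simp add: distr_distr)
  also have "\<dots> = D"
    using f g by (simp add: Prob_def)
  finally show "Comp Prob A B D g f \<in> Hom Prob A D"
    using c by (auto simp: Prob_def)
next
  fix A B D E :: "'a measure" and f g h
  assume "f \<in> Hom Prob A B" "g \<in> Hom Prob B D" "h \<in> Hom Prob D E"
  then show "Comp Prob A D E h (Comp Prob A B D g f) = Comp Prob A B E (Comp Prob B D E h g) f"
    by (auto simp: Prob_def compose_def fun_eq_iff dest: measurable_space)
qed (auto simp: Prob_def compose_def fun_eq_iff extensional_def dest: measurable_space)

section \<open>Transporting functoriality along isomorphisms\<close>

text \<open>The functor laws for \<open>F\<close> are not assumed.  Both sides of such a law become equal after composing
  with a component of \<open>\<eta>\<close>, by the naturality squares and the corresponding law for \<open>G\<close>, and that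
  component is a monomorphism.\<close>
lemma natural_isomorphismI:
  assumes G: "functor_between C D G"
    and obj: "\<And>A. A \<in> Obj C \<Longrightarrow> on_obj F A \<in> Obj D"
    and hom: "\<And>A B f. A \<in> Obj C \<Longrightarrow> B \<in> Obj C \<Longrightarrow> f \<in> Hom C A B \<Longrightarrow>
      on_hom F A B f \<in> Hom D (on_obj F A) (on_obj F B)"
    and iso: "\<And>A. A \<in> Obj C \<Longrightarrow> isomorphism D (on_obj F A) (on_obj G A) (\<eta> A)"
    and nat: "\<And>A B f. A \<in> Obj C \<Longrightarrow> B \<in> Obj C \<Longrightarrow> f \<in> Hom C A B \<Longrightarrow>
      Comp D (on_obj F A) (on_obj F B) (on_obj G B) (\<eta> B) (on_hom F A B f) =
      Comp D (on_obj F A) (on_obj G A) (on_obj G B) (on_hom G A B f) (\<eta> A)"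
  shows "natural_isomorphism C D F G \<eta>"
proof -
  interpret G: functor_between C D G by (rule G)
  have \<eta>: "\<eta> A \<in> Hom D (on_obj F A) (on_obj G A)" if "A \<in> Obj C" for A
    using iso[OF that] by (simp add: isomorphism_def)
  have mono: "u = v"
    if A: "A \<in> Obj C" and X: "X \<in> Obj D"
      and uv: "u \<in> Hom D X (on_obj F A)" "v \<in> Hom D X (on_obj F A)"
      and eq: "Comp D X (on_obj F A) (on_obj G A) (\<eta> A) u = Comp D X (on_obj F A) (on_obj G A) (\<eta> A) v"
    for A X u v
  proof -
    obtain k where k: "k \<in> Hom D (on_obj G A) (on_obj F A)"
      and k\<eta>: "Comp D (on_obj F A) (on_obj G A) (on_obj F A) k (\<eta> A) = Ident D (on_obj F A)"
      using iso[OF A] by (auto simp: isomorphism_def)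
    have "w = Comp D X (on_obj G A) (on_obj F A) k (Comp D X (on_obj F A) (on_obj G A) (\<eta> A) w)"
      if "w \<in> Hom D X (on_obj F A)" for w
      using G.cod.comp_assoc[OF X obj[OF A] G.on_obj_in[OF A] obj[OF A] that \<eta>[OF A] k]
        G.cod.ident_comp[OF X obj[OF A] that] by (simp add: k\<eta>)
    from this[OF uv(1)] this[OF uv(2)] eq show ?thesis
      by simp
  qed
  interpret F: functor_between C D F
  proof
    fix A assume A: "A \<in> Obj C"
    then have id: "Ident C A \<in> Hom C A A"
      by (rule G.dom.ident_in_hom)
    show "on_hom F A A (Ident C A) = Ident D (on_obj F A)"
      by (rule mono[OF A obj[OF A]])
        (simp_all add: A id hom obj nat \<eta> G.cod.ident_in_hom G.on_hom_ident G.on_obj_in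
          G.cod.comp_ident G.cod.ident_comp)
  next
    fix A B E f g
    assume O: "A \<in> Obj C" "B \<in> Obj C" "E \<in> Obj C" and f: "f \<in> Hom C A B" and g: "g \<in> Hom C B E"
    note gf = G.dom.comp_in_hom[OF O f g]
    note FO = obj[OF O(1)] obj[OF O(2)] obj[OF O(3)]
    note GO = G.on_obj_in[OF O(1)] G.on_obj_in[OF O(2)] G.on_obj_in[OF O(3)]
    note Ff = hom[OF O(1,2) f] and Fg = hom[OF O(2,3) g]
    note Gf = G.on_hom_in[OF O(1,2) f] and Gg = G.on_hom_in[OF O(2,3) g]
    show "on_hom F A E (Comp C A B E g f) =
      Comp D (on_obj F A) (on_obj F B) (on_obj F E) (on_hom F B E g) (on_hom F A B f)"
    proof (rule mono[OF O(3) FO(1) hom[OF O(1,3) gf] G.cod.comp_in_hom[OF FO Ff Fg]])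
      have "Comp D (on_obj F A) (on_obj F E) (on_obj G E) (\<eta> E) (on_hom F A E (Comp C A B E g f)) =
        Comp D (on_obj F A) (on_obj G A) (on_obj G E)
          (Comp D (on_obj G A) (on_obj G B) (on_obj G E) (on_hom G B E g) (on_hom G A B f)) (\<eta> A)"
        by (simp add: nat O gf G.on_hom_comp[OF O f g])
      also have "\<dots> = Comp D (on_obj F A) (on_obj G B) (on_obj G E) (on_hom G B E g)
          (Comp D (on_obj F A) (on_obj F B) (on_obj G B) (\<eta> B) (on_hom F A B f))"
        by (simp add: nat O f G.cod.comp_assoc[OF FO(1) GO \<eta>[OF O(1)] Gf Gg])
      also have "\<dots> = Comp D (on_obj F A) (on_obj F B) (on_obj G E)
          (Comp D (on_obj F B) (on_obj F E) (on_obj G E) (\<eta> E) (on_hom F B E g)) (on_hom F A B f)"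
        by (simp add: nat O g G.cod.comp_assoc[OF FO(1,2) GO(2,3) Ff \<eta>[OF O(2)] Gg])
      also have "\<dots> = Comp D (on_obj F A) (on_obj F E) (on_obj G E) (\<eta> E)
          (Comp D (on_obj F A) (on_obj F B) (on_obj F E) (on_hom F B E g) (on_hom F A B f))"
        by (simp add: G.cod.comp_assoc[OF FO GO(3) Ff Fg \<eta>[OF O(3)]])
      finally show "Comp D (on_obj F A) (on_obj F E) (on_obj G E) (\<eta> E) (on_hom F A E (Comp C A B E g f)) =
        Comp D (on_obj F A) (on_obj F E) (on_obj G E) (\<eta> E)
          (Comp D (on_obj F A) (on_obj F B) (on_obj F E) (on_hom F B E g) (on_hom F A B f))" .
    qed
  qed (fact obj hom)+
  show ?thesis
    by unfold_locales (fact \<eta> nat iso)+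
qed

section \<open>Classes of integrable random variables\<close>

lemma equiv_as_equal: "equiv (nonneg_integrable \<Omega>) (as_equal \<Omega>)"
  by (intro equivI refl_onI symI transI) (auto simp: as_equal_def)

lemma rep_RV_space:
  assumes "X \<in> points (RV_space \<Omega>)"
  shows "rep X \<in> nonneg_integrable \<Omega>" "as_equal \<Omega> `` {rep X} = X"
proof -
  obtain f where f: "f \<in> nonneg_integrable \<Omega>" "X = as_equal \<Omega> `` {f}"
    using assms by (auto simp: RV_space_def elim: quotientE)
  have "f \<in> X"
    unfolding f(2) by (rule equiv_class_self[OF equiv_as_equal f(1)])
  then have "rep X \<in> X"
    unfolding rep_def by (rule someI[where P="\<lambda>f. f \<in> X"])
  then have e: "(f, rep X) \<in> as_equal \<Omega>"
    using f by simp
  then show "rep X \<in> nonneg_integrable \<Omega>"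
    by (simp add: as_equal_def)
  show "as_equal \<Omega> `` {rep X} = X"
    using equiv_class_eq[OF equiv_as_equal e] f by simp
qed

lemma as_equalD: "(f, h) \<in> as_equal \<Omega> \<Longrightarrow> AE \<omega> in \<Omega>. f \<omega> = h \<omega>"
  by (simp add: as_equal_def)

lemma rep_class:
  assumes "f \<in> nonneg_integrable \<Omega>"
  shows "as_equal \<Omega> `` {f} \<in> points (RV_space \<Omega>)" "AE \<omega> in \<Omega>. rep (as_equal \<Omega> `` {f}) \<omega> = f \<omega>"
proof -
  show X: "as_equal \<Omega> `` {f} \<in> points (RV_space \<Omega>)"
    using assms by (simp add: RV_space_def quotientI)
  have "(rep (as_equal \<Omega> `` {f}), f) \<in> as_equal \<Omega>"
    using eq_equiv_class[OF rep_RV_space(2)[OF X] equiv_as_equal assms] .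
  then show "AE \<omega> in \<Omega>. rep (as_equal \<Omega> `` {f}) \<omega> = f \<omega>"
    by (rule as_equalD)
qed

lemma nonneg_integrableD:
  assumes "f \<in> nonneg_integrable \<Omega>"
  shows "integrable \<Omega> f" "f \<in> borel_measurable \<Omega>" "\<And>\<omega>. \<omega> \<in> space \<Omega> \<Longrightarrow> 0 \<le> f \<omega>"
  using assms by (auto simp: nonneg_integrable_def)

lemma RV_space_eqI:
  assumes X: "X \<in> points (RV_space \<Omega>)" and Y: "Y \<in> points (RV_space \<Omega>)"
    and d: "edist (RV_space \<Omega>) X Y = 0"
  shows "X = Y"
proof -
  note rX = rep_RV_space[OF X] and rY = rep_RV_space[OF Y]
  note [measurable] = nonneg_integrableD(2)[OF rX(1)] nonneg_integrableD(2)[OF rY(1)]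
  have "AE \<omega> in \<Omega>. ennreal \<bar>rep X \<omega> - rep Y \<omega>\<bar> = 0"
    using d by (subst (asm) RV_space_def) (simp add: nn_integral_0_iff_AE)
  then have "(rep X, rep Y) \<in> as_equal \<Omega>"
    using rX rY by (auto simp: as_equal_def)
  from equiv_class_eq[OF equiv_as_equal this] show ?thesis
    by (simp add: rX rY)
qed

text \<open>An \<open>L\<^sup>1\<close> limit \<open>g\<close> of nonnegative functions is nonnegative only almost everywhere.  Its absolute
  value is a valid representative of the limit class, and it is no further than \<open>g\<close> from any
  nonnegative function.\<close>
lemma RV_space_in_CMet: "RV_space \<Omega> \<in> Obj CMet"
proof -
  let ?d = "edist (RV_space \<Omega>)"
  have d: "?d X Y = (\<integral>\<^sup>+\<omega>. ennreal \<bar>rep X \<omega> - rep Y \<omega>\<bar> \<partial>\<Omega>)" for X Y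
    by (simp add: RV_space_def)
  have "?d X Z \<le> ?d X Y + ?d Y Z"
    if "X \<in> points (RV_space \<Omega>)" "Y \<in> points (RV_space \<Omega>)" "Z \<in> points (RV_space \<Omega>)" for X Y Z
  proof -
    note [measurable] = that[THEN rep_RV_space(1), THEN nonneg_integrableD(2)]
    have "?d X Z \<le> (\<integral>\<^sup>+\<omega>. ennreal \<bar>rep X \<omega> - rep Y \<omega>\<bar> + ennreal \<bar>rep Y \<omega> - rep Z \<omega>\<bar> \<partial>\<Omega>)"
      unfolding d by (intro nn_integral_mono) (simp add: ennreal_plus[symmetric] del: ennreal_plus)
    also have "\<dots> = ?d X Y + ?d Y Z"
      unfolding d by (rule nn_integral_add) simp_all
    finally show ?thesis .
  qed
  then have "ext_pseudometric_space (RV_space \<Omega>)"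
    by (simp add: ext_pseudometric_space_def d abs_minus_commute)
  moreover have "em_complete (RV_space \<Omega>)"
    unfolding em_complete_def
  proof (intro allI impI, elim conjE)
    fix s assume s: "range s \<subseteq> points (RV_space \<Omega>)" and C: "em_Cauchy (RV_space \<Omega>) s"
    have r: "rep (s n) \<in> nonneg_integrable \<Omega>" for n
      using s by (intro rep_RV_space) auto
    note int = nonneg_integrableD(1)[OF r]
    obtain g where g: "integrable \<Omega> g"
      and lim: "(\<lambda>n. \<integral>\<^sup>+\<omega>. ennreal \<bar>rep (s n) \<omega> - g \<omega>\<bar> \<partial>\<Omega>) \<longlonglongrightarrow> 0"
      by (rule L1_Cauchy_converges[of \<Omega> "\<lambda>n. rep (s n)", OF int])
        (use C in \<open>auto simp: em_Cauchy_def d\<close>)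
    let ?X = "as_equal \<Omega> `` {\<lambda>\<omega>. \<bar>g \<omega>\<bar>}"
    have "(\<lambda>\<omega>. \<bar>g \<omega>\<bar>) \<in> nonneg_integrable \<Omega>"
      using g by (auto simp: nonneg_integrable_def)
    note X = rep_class[OF this]
    have "?d (s n) ?X \<le> (\<integral>\<^sup>+\<omega>. ennreal \<bar>rep (s n) \<omega> - g \<omega>\<bar> \<partial>\<Omega>)" for n
      unfolding d
    proof (rule nn_integral_mono_AE, rule AE_mp[OF X(2)], intro AE_I2 impI ennreal_leI)
      fix \<omega> assume "\<omega> \<in> space \<Omega>" "rep ?X \<omega> = \<bar>g \<omega>\<bar>"
      moreover have "0 \<le> rep (s n) \<omega>"
        using r \<open>\<omega> \<in> space \<Omega>\<close> by (rule nonneg_integrableD)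
      ultimately show "\<bar>rep (s n) \<omega> - rep ?X \<omega>\<bar> \<le> \<bar>rep (s n) \<omega> - g \<omega>\<bar>"
        by simp
    qed
    then have "(\<lambda>n. ?d (s n) ?X) \<longlonglongrightarrow> 0"
      by (intro tendsto_sandwich[OF _ _ tendsto_const lim]) simp_all
    with X(1) show "\<exists>x\<in>points (RV_space \<Omega>). (\<lambda>n. ?d (s n) x) \<longlonglongrightarrow> 0"
      by blast
  qed
  ultimately show ?thesis
    by (simp add: CMet_def)
qed

section \<open>Densities as an isometry onto the absolutely continuous measures\<close>

lemma measure_density_nonneg_integrable:
  assumes f: "f \<in> nonneg_integrable \<Omega>" and A: "A \<in> sets \<Omega>"
  shows "measure (density \<Omega> (\<lambda>\<omega>. ennreal (f \<omega>))) A = (LINT \<omega>:A|\<Omega>. f \<omega>)"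
proof -
  note [measurable] = nonneg_integrableD(2)[OF f] A
  have "(LINT \<omega>:A|\<Omega>. f \<omega>) = enn2real (\<integral>\<^sup>+\<omega>. ennreal (indicator A \<omega> *\<^sub>R f \<omega>) \<partial>\<Omega>)"
    unfolding set_lebesgue_integral_def
    by (rule integral_eq_nn_integral) (auto simp: nonneg_integrableD(3)[OF f])
  also have "(\<integral>\<^sup>+\<omega>. ennreal (indicator A \<omega> *\<^sub>R f \<omega>) \<partial>\<Omega>) = emeasure (density \<Omega> (\<lambda>\<omega>. ennreal (f \<omega>))) A"
    by (subst emeasure_density) (auto intro!: nn_integral_cong split: split_indicator)
  finally show ?thesis
    by (simp add: measure_def)
qed

text \<open>Let \<open>\<nu>\<close> be the measure with density \<open>\<bar>f - h\<bar>\<close>.  The discrepancy of the two measures on a set \<open>A\<close> is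
  at most \<open>\<nu> A\<close>, so countable additivity of \<open>\<nu>\<close> bounds the sum over any partition by the total mass of
  \<open>\<nu>\<close>.  The discrepancy equals \<open>\<nu> A\<close> when \<open>f - h\<close> does not change sign on \<open>A\<close>, so the partition by the
  sign of \<open>f - h\<close>, padded with empty sets, attains the bound.\<close>
lemma total_variation_dist_density:
  assumes f: "f \<in> nonneg_integrable \<Omega>" and h: "h \<in> nonneg_integrable \<Omega>"
  shows "total_variation_dist \<Omega> (density \<Omega> (\<lambda>\<omega>. ennreal (f \<omega>))) (density \<Omega> (\<lambda>\<omega>. ennreal (h \<omega>))) =
    (\<integral>\<^sup>+\<omega>. ennreal \<bar>f \<omega> - h \<omega>\<bar> \<partial>\<Omega>)"
proof -
  note [measurable] = nonneg_integrableD(2)[OF f] nonneg_integrableD(2)[OF h]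
  define \<nu> where "\<nu> = density \<Omega> (\<lambda>\<omega>. ennreal \<bar>f \<omega> - h \<omega>\<bar>)"
  define D where "D A = ennreal \<bar>measure (density \<Omega> (\<lambda>\<omega>. ennreal (f \<omega>))) A -
    measure (density \<Omega> (\<lambda>\<omega>. ennreal (h \<omega>))) A\<bar>" for A
  have total: "emeasure \<nu> (space \<Omega>) = (\<integral>\<^sup>+\<omega>. ennreal \<bar>f \<omega> - h \<omega>\<bar> \<partial>\<Omega>)"
    by (simp add: \<nu>_def emeasure_density cong: nn_integral_cong)
  have sets_\<nu>: "sets \<nu> = sets \<Omega>"
    by (simp add: \<nu>_def)
  have int: "integrable \<Omega> (\<lambda>\<omega>. indicator A \<omega> *\<^sub>R (f \<omega> - h \<omega>))" if "A \<in> sets \<Omega>" for A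
    by (intro integrable_mult_indicator that Bochner_Integration.integrable_diff nonneg_integrableD(1)[OF f] nonneg_integrableD(1)[OF h])
  have D: "D A = ennreal \<bar>LINT \<omega>|\<Omega>. indicator A \<omega> *\<^sub>R (f \<omega> - h \<omega>)\<bar>" if A: "A \<in> sets \<Omega>" for A
  proof -
    have "set_integrable \<Omega> A f" "set_integrable \<Omega> A h"
      using A nonneg_integrableD(1)[OF f] nonneg_integrableD(1)[OF h]
      unfolding set_integrable_def by (blast intro: integrable_mult_indicator)+
    then show ?thesis
      using set_integral_diff(2)[of \<Omega> A f h]
      by (simp add: D_def measure_density_nonneg_integrable[OF f A] measure_density_nonneg_integrable[OF h A]
          set_lebesgue_integral_def)
  qed
  have \<nu>: "emeasure \<nu> A = (\<integral>\<^sup>+\<omega>. ennreal (norm (indicator A \<omega> *\<^sub>R (f \<omega> - h \<omega>))) \<partial>\<Omega>)" if "A \<in> sets \<Omega>" for A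
    using that unfolding \<nu>_def
    by (subst emeasure_density) (auto intro!: nn_integral_cong split: split_indicator)
  have le: "D A \<le> emeasure \<nu> A" if "A \<in> sets \<Omega>" for A
    using integral_norm_bound_ennreal[OF int[OF that]] by (simp add: D[OF that] \<nu>[OF that])
  have eq: "D A = emeasure \<nu> A"
    if A: "A \<in> sets \<Omega>" and sign: "(\<forall>\<omega>\<in>A. h \<omega> \<le> f \<omega>) \<or> (\<forall>\<omega>\<in>A. f \<omega> \<le> h \<omega>)" for A
  proof -
    let ?u = "\<lambda>\<omega>. indicator A \<omega> *\<^sub>R (f \<omega> - h \<omega>)"
    have "emeasure \<nu> A = ennreal (LINT \<omega>|\<Omega>. norm (?u \<omega>))"
      unfolding \<nu>[OF A] by (rule nn_integral_eq_integral[OF integrable_norm[OF int[OF A]]]) simp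
    moreover have "(LINT \<omega>|\<Omega>. norm (?u \<omega>)) = \<bar>LINT \<omega>|\<Omega>. ?u \<omega>\<bar>"
      using sign
    proof
      assume "\<forall>\<omega>\<in>A. h \<omega> \<le> f \<omega>"
      then have "norm (?u \<omega>) = ?u \<omega>" "0 \<le> ?u \<omega>" for \<omega>
        by (auto split: split_indicator)
      then show ?thesis
        by (simp add: abs_of_nonneg)
    next
      assume "\<forall>\<omega>\<in>A. f \<omega> \<le> h \<omega>"
      then have u: "norm (?u \<omega>) = - ?u \<omega>" "?u \<omega> \<le> 0" for \<omega>
        by (auto split: split_indicator)
      have "(LINT \<omega>|\<Omega>. ?u \<omega>) \<le> 0"
        using integral_nonneg_AE[of "\<lambda>\<omega>. - ?u \<omega>" \<Omega>] u(2) by simp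
      moreover have "(LINT \<omega>|\<Omega>. norm (?u \<omega>)) = - (LINT \<omega>|\<Omega>. ?u \<omega>)"
        unfolding u(1) by (rule Bochner_Integration.integral_minus)
      ultimately show ?thesis
        by linarith
    qed
    ultimately show ?thesis
      by (simp add: D[OF A])
  qed
  let ?P = "{\<omega>\<in>space \<Omega>. h \<omega> \<le> f \<omega>}" and ?N = "{\<omega>\<in>space \<Omega>. f \<omega> < h \<omega>}"
  show ?thesis
    unfolding total_variation_dist_def total[symmetric] D_def[symmetric]
  proof (rule antisym)
    show "(SUP A \<in> {A. range A \<subseteq> sets \<Omega> \<and> disjoint_family A \<and> \<Union> (range A) = space \<Omega>}. \<Sum>n. D (A n))
      \<le> emeasure \<nu> (space \<Omega>)"
    proof (rule SUP_least, clarify)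
      fix A :: "nat \<Rightarrow> 'a set"
      assume A: "range A \<subseteq> sets \<Omega>" "disjoint_family A" "\<Union> (range A) = space \<Omega>"
      have "(\<Sum>n. D (A n)) \<le> (\<Sum>n. emeasure \<nu> (A n))"
        using A(1) by (intro suminf_le le) auto
      also have "\<dots> = emeasure \<nu> (space \<Omega>)"
        using A suminf_emeasure[of A \<nu>] by (simp add: sets_\<nu>)
      finally show "(\<Sum>n. D (A n)) \<le> emeasure \<nu> (space \<Omega>)" .
    qed
    have "emeasure \<nu> (space \<Omega>) = emeasure \<nu> ?P + emeasure \<nu> ?N"
      by (subst plus_emeasure) (auto simp: sets_\<nu> intro!: arg_cong[where f="emeasure \<nu>"])
    also have "\<dots> = D ?P + D ?N"
      by (subst (1 2) eq) auto
    also have "\<dots> = (\<Sum>n. D (binaryset ?P ?N n))"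
      by (rule suminf_binaryset_eq[symmetric]) (simp add: D_def)
    also have "\<dots> \<le> (SUP A \<in> {A. range A \<subseteq> sets \<Omega> \<and> disjoint_family A \<and> \<Union> (range A) = space \<Omega>}. \<Sum>n. D (A n))"
      by (rule SUP_upper)
        (auto simp: range_binaryset_eq UN_binaryset_eq disjoint_family_on_def binaryset_def)
    finally show "emeasure \<nu> (space \<Omega>) \<le>
      (SUP A \<in> {A. range A \<subseteq> sets \<Omega> \<and> disjoint_family A \<and> \<Union> (range A) = space \<Omega>}. \<Sum>n. D (A n))" .
  qed
qed

lemma edist_M_space: "edist (M_space \<Omega>) = total_variation_dist \<Omega>"
  by (simp add: M_space_def)

text \<open>The map \<open>\<iota>\<close> above: \<^term>\<open>\<rho>\<close> is this map with its points renamed into the disjoint sum.\<close>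
definition integral_measure :: "'a measure \<Rightarrow> ('a \<Rightarrow> real) set \<Rightarrow> 'a measure" where
  "integral_measure \<Omega> X = density \<Omega> (\<lambda>\<omega>. ennreal (rep X \<omega>))"

lemma density_in_M_space:
  assumes f: "f \<in> nonneg_integrable \<Omega>"
  shows "density \<Omega> (\<lambda>\<omega>. ennreal (f \<omega>)) \<in> points (M_space \<Omega>)"
proof -
  note [measurable] = nonneg_integrableD(2)[OF f]
  have "(\<integral>\<^sup>+\<omega>. ennreal (f \<omega>) \<partial>\<Omega>) = ennreal (LINT \<omega>|\<Omega>. f \<omega>)"
    using nonneg_integrableD[OF f] by (intro nn_integral_eq_integral) auto
  then have "finite_measure (density \<Omega> (\<lambda>\<omega>. ennreal (f \<omega>)))"
    by (intro finite_measureI) (simp add: emeasure_density cong: nn_integral_cong)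
  then show ?thesis
    by (simp add: M_space_def absolutely_continuousI_density)
qed

text \<open>The Radon-Nikodym theorem.  The density is finite almost everywhere because \<open>\<mu>\<close> is finite, which
  permits a real-valued version; its integral is the total mass of \<open>\<mu>\<close>.\<close>
lemma (in finite_measure) M_space_density:
  assumes \<mu>: "\<mu> \<in> points (M_space M)"
  obtains f where "f \<in> nonneg_integrable M" "density M (\<lambda>\<omega>. ennreal (f \<omega>)) = \<mu>"
proof -
  have sets: "sets \<mu> = sets M" and ac: "absolutely_continuous M \<mu>" and fin: "finite_measure \<mu>"
    using \<mu> by (auto simp: M_space_def)
  obtain f where f: "f \<in> borel_measurable M" "\<And>x. 0 \<le> f x" "density M (\<lambda>\<omega>. ennreal (f \<omega>)) = \<mu>"
  proof -
    obtain D where D: "D \<in> borel_measurable M" "AE x in M. RN_deriv M \<mu> x = ennreal (D x)" "\<And>x. 0 \<le> D x"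
      using real_RN_deriv[OF fin ac sets] by blast
    have "density M (\<lambda>\<omega>. ennreal (D \<omega>)) = density M (RN_deriv M \<mu>)"
      using D by (intro density_cong) auto
    with D density_RN_deriv[OF ac sets] show thesis
      by (intro that) auto
  qed
  note [measurable] = f(1)
  have "(\<integral>\<^sup>+\<omega>. ennreal (f \<omega>) \<partial>M) = emeasure \<mu> (space M)"
    unfolding f(3)[symmetric] by (simp add: emeasure_density cong: nn_integral_cong)
  also have "\<dots> < \<infinity>"
    using finite_measure.emeasure_finite[OF fin] by (simp add: less_top)
  finally have "integrable M f"
    by (intro integrableI_nonneg) (auto simp: f)
  then show thesis
    using that f by (auto simp: nonneg_integrable_def)
qed

lemma isometry_integral_measure:
  assumes "finite_measure \<Omega>"
  shows "isometry (RV_space \<Omega>) (M_space \<Omega>) (integral_measure \<Omega>)"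
proof -
  have iso: "edist (M_space \<Omega>) (integral_measure \<Omega> X) (integral_measure \<Omega> Y) = edist (RV_space \<Omega>) X Y"
    if "X \<in> points (RV_space \<Omega>)" "Y \<in> points (RV_space \<Omega>)" for X Y
    using total_variation_dist_density[OF that[THEN rep_RV_space(1)]]
    by (simp add: M_space_def RV_space_def integral_measure_def)
  have "inj_on (integral_measure \<Omega>) (points (RV_space \<Omega>))"
  proof (rule inj_onI)
    fix X Y assume XY: "X \<in> points (RV_space \<Omega>)" "Y \<in> points (RV_space \<Omega>)"
      and eq: "integral_measure \<Omega> X = integral_measure \<Omega> Y"
    have "edist (M_space \<Omega>) (integral_measure \<Omega> Y) (integral_measure \<Omega> Y) = 0"
      by (simp add: M_space_def total_variation_dist_def SUP_constant bot_ennreal)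
    then show "X = Y"
      using iso[OF XY] eq by (intro RV_space_eqI[OF XY]) simp
  qed
  moreover have "integral_measure \<Omega> ` points (RV_space \<Omega>) = points (M_space \<Omega>)"
  proof (intro antisym subsetI; (elim imageE)?)
    fix \<mu> X assume "X \<in> points (RV_space \<Omega>)" "\<mu> = integral_measure \<Omega> X"
    then show "\<mu> \<in> points (M_space \<Omega>)"
      by (simp add: integral_measure_def density_in_M_space rep_RV_space)
  next
    fix \<mu> assume "\<mu> \<in> points (M_space \<Omega>)"
    then obtain f where f: "f \<in> nonneg_integrable \<Omega>" "density \<Omega> (\<lambda>\<omega>. ennreal (f \<omega>)) = \<mu>"
      by (rule finite_measure.M_space_density[OF assms])
    note X = rep_class[OF f(1)]
    have "integral_measure \<Omega> (as_equal \<Omega> `` {f}) = density \<Omega> (\<lambda>\<omega>. ennreal (f \<omega>))"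
      unfolding integral_measure_def
      using nonneg_integrableD(2)[OF f(1)] nonneg_integrableD(2)[OF rep_RV_space(1)[OF X(1)]] X(2)
      by (intro density_cong) auto
    then show "\<mu> \<in> integral_measure \<Omega> ` points (RV_space \<Omega>)"
      using X(1) f(2) by (intro image_eqI[of _ _ "as_equal \<Omega> `` {f}"]) auto
  qed
  ultimately show ?thesis
    using iso by (simp add: isometry_def bij_betw_def)
qed

lemma M_space_in_CMet: "finite_measure \<Omega> \<Longrightarrow> M_space \<Omega> \<in> Obj CMet"
  by (rule isometry_Obj_CMet[OF isometry_integral_measure RV_space_in_CMet])

section \<open>Pushforward of measures\<close>

lemma Hom_ProbD:
  assumes "g \<in> Hom Prob \<Omega>1 \<Omega>2"
  shows "g \<in> measurable \<Omega>1 \<Omega>2" "distr \<Omega>1 \<Omega>2 g = \<Omega>2"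
  using assms by (auto simp: Prob_def)

text \<open>Absolute continuity survives the pushforward because \<open>g\<close> preserves measure: the preimage of a
  null set is a null set.\<close>
lemma distr_in_M_space:
  assumes \<mu>: "\<mu> \<in> points (M_space \<Omega>1)" and g: "g \<in> Hom Prob \<Omega>1 \<Omega>2"
  shows "distr \<mu> \<Omega>2 g \<in> points (M_space \<Omega>2)"
proof -
  note gm [measurable] = Hom_ProbD(1)[OF g]
  have sets: "sets \<mu> = sets \<Omega>1" and sp: "space \<mu> = space \<Omega>1"
    and ac: "absolutely_continuous \<Omega>1 \<mu>" and fin: "finite_measure \<mu>"
    using \<mu> by (auto simp: M_space_def dest: sets_eq_imp_space_eq)
  have gm' [measurable]: "g \<in> measurable \<mu> \<Omega>2"
    using gm by (simp add: measurable_cong_sets[OF sets refl])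
  have "N \<in> null_sets (distr \<mu> \<Omega>2 g)" if N: "N \<in> null_sets \<Omega>2" for N
  proof -
    have NS: "N \<in> sets \<Omega>2"
      using N by auto
    have "emeasure \<Omega>1 (g -` N \<inter> space \<Omega>1) = emeasure (distr \<Omega>1 \<Omega>2 g) N"
      using NS by (simp add: emeasure_distr)
    also have "\<dots> = 0"
      using N by (simp add: Hom_ProbD(2)[OF g] null_setsD1)
    finally have "g -` N \<inter> space \<Omega>1 \<in> null_sets \<Omega>1"
      using NS by (intro null_setsI) auto
    then have "emeasure \<mu> (g -` N \<inter> space \<Omega>1) = 0"
      using ac by (auto simp: absolutely_continuous_def)
    then show ?thesis
      using NS by (intro null_setsI) (simp_all add: emeasure_distr sp)
  qed
  then show ?thesis
    using finite_measure.finite_measure_distr[OF fin gm'] by (auto simp: M_space_def absolutely_continuous_def)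
qed

lemma measure_distr_M_space:
  assumes \<mu>: "\<mu> \<in> points (M_space \<Omega>1)" and g: "g \<in> Hom Prob \<Omega>1 \<Omega>2" and B: "B \<in> sets \<Omega>2"
  shows "measure (distr \<mu> \<Omega>2 g) B = measure \<mu> (g -` B \<inter> space \<Omega>1)"
proof -
  have sets: "sets \<mu> = sets \<Omega>1" and sp: "space \<mu> = space \<Omega>1"
    using \<mu> by (auto simp: M_space_def dest: sets_eq_imp_space_eq)
  have "g \<in> measurable \<mu> \<Omega>2"
    using Hom_ProbD(1)[OF g] by (simp add: measurable_cong_sets[OF sets refl])
  from measure_distr[OF this B] show ?thesis
    by (simp add: sp)
qed

text \<open>Preimages turn a partition of \<open>\<Omega>2\<close> into a partition of \<open>\<Omega>1\<close> with the same discrepancies, so the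
  supremum for \<open>\<Omega>2\<close> ranges over fewer sums.\<close>
lemma total_variation_dist_distr_le:
  assumes \<mu>: "\<mu> \<in> points (M_space \<Omega>1)" and \<nu>: "\<nu> \<in> points (M_space \<Omega>1)" and g: "g \<in> Hom Prob \<Omega>1 \<Omega>2"
  shows "total_variation_dist \<Omega>2 (distr \<mu> \<Omega>2 g) (distr \<nu> \<Omega>2 g) \<le> total_variation_dist \<Omega>1 \<mu> \<nu>"
  unfolding total_variation_dist_def
proof (rule SUP_least, clarify)
  fix A :: "nat \<Rightarrow> 'a set"
  assume A: "range A \<subseteq> sets \<Omega>2" "disjoint_family A" "\<Union> (range A) = space \<Omega>2"
  let ?A = "\<lambda>n. g -` A n \<inter> space \<Omega>1"
  note gm = Hom_ProbD(1)[OF g]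
  have "range ?A \<subseteq> sets \<Omega>1"
    using A(1) gm by (auto intro: measurable_sets)
  moreover have "disjoint_family ?A"
    using A(2) by (auto simp: disjoint_family_on_def)
  moreover have "\<Union> (range ?A) = space \<Omega>1"
    using measurable_space[OF gm, folded A(3)] by auto
  ultimately have "(\<Sum>n. ennreal \<bar>measure \<mu> (?A n) - measure \<nu> (?A n)\<bar>) \<le>
    (SUP A \<in> {A. range A \<subseteq> sets \<Omega>1 \<and> disjoint_family A \<and> \<Union> (range A) = space \<Omega>1}.
      \<Sum>n. ennreal \<bar>measure \<mu> (A n) - measure \<nu> (A n)\<bar>)"
    by (intro SUP_upper2[of ?A]) auto
  moreover have "measure (distr \<mu> \<Omega>2 g) (A n) = measure \<mu> (?A n)"
      "measure (distr \<nu> \<Omega>2 g) (A n) = measure \<nu> (?A n)" for n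
    using A(1) by (auto intro!: measure_distr_M_space[OF \<mu> g] measure_distr_M_space[OF \<nu> g])
  ultimately show "(\<Sum>n. ennreal \<bar>measure (distr \<mu> \<Omega>2 g) (A n) - measure (distr \<nu> \<Omega>2 g) (A n)\<bar>) \<le>
    (SUP A \<in> {A. range A \<subseteq> sets \<Omega>1 \<and> disjoint_family A \<and> \<Union> (range A) = space \<Omega>1}.
      \<Sum>n. ennreal \<bar>measure \<mu> (A n) - measure \<nu> (A n)\<bar>)"
    by simp
qed

section \<open>Conditional expectation as pushforward of densities\<close>

text \<open>The two integrals over \<open>B\<close> are the values at \<open>B\<close> of the two finite measures on the right, and a
  finite measure is determined by its values.\<close>
lemma cond_exp_along_iff:
  assumes X: "X \<in> points (RV_space \<Omega>1)" and Y: "Y \<in> points (RV_space \<Omega>2)" and g: "g \<in> Hom Prob \<Omega>1 \<Omega>2"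
  shows "(\<forall>B \<in> sets \<Omega>2. (LINT \<omega>:(g -` B \<inter> space \<Omega>1)|\<Omega>1. rep X \<omega>) = (LINT \<omega>:B|\<Omega>2. rep Y \<omega>)) \<longleftrightarrow>
    integral_measure \<Omega>2 Y = distr (integral_measure \<Omega>1 X) \<Omega>2 g"
proof -
  note rX = rep_RV_space(1)[OF X] and rY = rep_RV_space(1)[OF Y]
  have MX: "integral_measure \<Omega>1 X \<in> points (M_space \<Omega>1)"
    and MY: "integral_measure \<Omega>2 Y \<in> points (M_space \<Omega>2)"
    unfolding integral_measure_def by (intro density_in_M_space rX rY)+
  note MD = distr_in_M_space[OF MX g]
  have "(LINT \<omega>:(g -` B \<inter> space \<Omega>1)|\<Omega>1. rep X \<omega>) = measure (distr (integral_measure \<Omega>1 X) \<Omega>2 g) B"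
      "(LINT \<omega>:B|\<Omega>2. rep Y \<omega>) = measure (integral_measure \<Omega>2 Y) B" if B: "B \<in> sets \<Omega>2" for B
    unfolding measure_distr_M_space[OF MX g B] unfolding integral_measure_def
    using measurable_sets[OF Hom_ProbD(1)[OF g] B]
    by (simp_all add: measure_density_nonneg_integrable[OF rX] measure_density_nonneg_integrable[OF rY B])
  then show ?thesis
    using MY MD
    by (auto simp: M_space_def finite_measure.emeasure_eq_measure intro!: measure_eqI)
qed

text \<open>Existence and uniqueness of the class selected by the definite description both come from the
  bijectivity of the density map, applied to the pushed-forward measure.\<close>
lemma cond_exp_along:
  assumes fin: "finite_measure \<Omega>2"
    and X: "X \<in> points (RV_space \<Omega>1)" and g: "g \<in> Hom Prob \<Omega>1 \<Omega>2"
  shows "cond_exp_along \<Omega>1 \<Omega>2 g X \<in> points (RV_space \<Omega>2)"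
    and "integral_measure \<Omega>2 (cond_exp_along \<Omega>1 \<Omega>2 g X) = distr (integral_measure \<Omega>1 X) \<Omega>2 g"
proof -
  note b = isometry_integral_measure[OF fin, unfolded isometry_def, THEN conjunct1]
  have "distr (integral_measure \<Omega>1 X) \<Omega>2 g \<in> points (M_space \<Omega>2)"
    unfolding integral_measure_def by (intro distr_in_M_space[OF _ g] density_in_M_space rep_RV_space X)
  then obtain Y where Y: "Y \<in> points (RV_space \<Omega>2)"
    and eq: "integral_measure \<Omega>2 Y = distr (integral_measure \<Omega>1 X) \<Omega>2 g"
    unfolding bij_betw_imp_surj_on[OF b, symmetric] by (metis imageE)
  have "cond_exp_along \<Omega>1 \<Omega>2 g X = Y"
    unfolding cond_exp_along_def
  proof (rule the_equality)
    fix Z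
    assume "Z \<in> points (RV_space \<Omega>2) \<and>
     (\<forall>B \<in> sets \<Omega>2. (LINT \<omega>:(g -` B \<inter> space \<Omega>1)|\<Omega>1. rep X \<omega>) = (LINT \<omega>:B|\<Omega>2. rep Z \<omega>))"
    then show "Z = Y"
      using cond_exp_along_iff[OF X _ g, of Z] eq b Y by (auto simp: bij_betw_def inj_on_def)
  qed (use cond_exp_along_iff[OF X Y g] Y eq in blast)
  then show "cond_exp_along \<Omega>1 \<Omega>2 g X \<in> points (RV_space \<Omega>2)"
    and "integral_measure \<Omega>2 (cond_exp_along \<Omega>1 \<Omega>2 g X) = distr (integral_measure \<Omega>1 X) \<Omega>2 g"
    using Y eq by simp_all
qed

text \<open>The contraction property is that of the pushforward, read through the isometries on both sides.\<close>
lemma cond_exp_along_contraction: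
  assumes "finite_measure \<Omega>1" "finite_measure \<Omega>2" and g: "g \<in> Hom Prob \<Omega>1 \<Omega>2"
    and X: "X \<in> points (RV_space \<Omega>1)" and Y: "Y \<in> points (RV_space \<Omega>1)"
  shows "edist (RV_space \<Omega>2) (cond_exp_along \<Omega>1 \<Omega>2 g X) (cond_exp_along \<Omega>1 \<Omega>2 g Y) \<le>
    edist (RV_space \<Omega>1) X Y"
proof -
  note iso = assms(1,2)[THEN isometry_integral_measure]
  note cX = cond_exp_along[OF assms(2) X g] and cY = cond_exp_along[OF assms(2) Y g]
  show ?thesis
    using total_variation_dist_distr_le[OF isometry_in[OF iso(1) X] isometry_in[OF iso(1) Y] g]
    unfolding isometry_edist[OF iso(2) cX(1) cY(1), symmetric] cX(2) cY(2)
      isometry_edist[OF iso(1) X Y, symmetric]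
    by (simp add: M_space_def)
qed

section \<open>The functors on renamed spaces\<close>

lemma transport_map_in_CMet:
  assumes "inj i" "inj j"
    and "\<And>x. x \<in> points X \<Longrightarrow> f x \<in> points Y"
    and "\<And>x y. x \<in> points X \<Longrightarrow> y \<in> points X \<Longrightarrow> edist Y (f x) (f y) \<le> edist X x y"
  shows "transport_map i j X f \<in> Hom CMet (transport i X) (transport j Y)"
  using assms by (auto simp: CMet_def transport_def transport_map_def)

lemma compose_transport_map:
  assumes "inj i" "inj j" "\<And>x. x \<in> points X \<Longrightarrow> f x \<in> points Y"
  shows "Comp CMet (transport i X) (transport j Y) Z (transport_map j k Y h) (transport_map i j X f) =
    transport_map i k X (\<lambda>x. h (f x))"
  using assms by (auto simp: CMet_def transport_def transport_map_def compose_def fun_eq_iff)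

lemma transport_map_cong:
  assumes "inj i" "\<And>x. x \<in> points X \<Longrightarrow> f x = h x"
  shows "transport_map i j X f = transport_map i j X h"
  using assms by (auto simp: transport_map_def fun_eq_iff)

lemma transport_map_ident:
  "inj i \<Longrightarrow> transport_map i i X (\<lambda>x. x) = Ident CMet (transport i X)"
  by (auto simp: CMet_def transport_def transport_map_def fun_eq_iff)

lemma functor_M: "functor_between (Prob :: ('a measure, 'a \<Rightarrow> 'a) cat)
    (CMet :: ('a point emspace, 'a point \<Rightarrow> 'a point) cat) M_functor"
proof -
  interpret P: category "Prob :: ('a measure, 'a \<Rightarrow> 'a) cat" by (rule category_Prob)
  interpret C: category "CMet :: ('a point emspace, 'a point \<Rightarrow> 'a point) cat" by (rule category_CMet)
  show ?thesis
  proof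
    fix \<Omega> :: "'a measure" assume \<Omega>: "\<Omega> \<in> Obj Prob"
    then have "finite_measure \<Omega>"
      by (simp add: Prob_def prob_space.finite_measure)
    then show "on_obj M_functor \<Omega> \<in> Obj CMet"
      using isometry_Obj_CMet[OF isometry_transport M_space_in_CMet, of Inr \<Omega>]
      by (simp add: M_functor_def)
    have "distr \<mu> \<Omega> (restrict (\<lambda>x. x) (space \<Omega>)) = \<mu>" if "\<mu> \<in> points (M_space \<Omega>)" for \<mu>
    proof -
      have sets: "sets \<mu> = sets \<Omega>"
        using that by (simp add: M_space_def)
      have "distr \<mu> \<Omega> (restrict (\<lambda>x. x) (space \<Omega>)) = distr \<mu> \<mu> (\<lambda>x. x)"
        using sets_eq_imp_space_eq[OF sets] by (intro distr_cong) (auto simp: sets)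
      then show ?thesis
        by (simp add: distr_id)
    qed
    then have "transport_map Inr Inr (M_space \<Omega>) (\<lambda>\<mu>. distr \<mu> \<Omega> (restrict (\<lambda>x. x) (space \<Omega>))) =
      transport_map Inr Inr (M_space \<Omega>) (\<lambda>\<mu>. \<mu>)"
      by (intro transport_map_cong) auto
    then show "on_hom M_functor \<Omega> \<Omega> (Ident Prob \<Omega>) = Ident CMet (on_obj M_functor \<Omega>)"
      by (simp add: M_functor_def Prob_def transport_map_ident)
  next
    fix A B :: "'a measure" and g assume g: "g \<in> Hom Prob A B"
    show "on_hom M_functor A B g \<in> Hom CMet (on_obj M_functor A) (on_obj M_functor B)"
      using distr_in_M_space[OF _ g] total_variation_dist_distr_le[OF _ _ g]
      by (simp add: M_functor_def transport_map_in_CMet edist_M_space)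
  next
    fix A B E :: "'a measure" and f g assume f: "f \<in> Hom Prob A B" and g: "g \<in> Hom Prob B E"
    have "distr \<mu> E (compose (space A) g f) = distr (distr \<mu> B f) E g" if "\<mu> \<in> points (M_space A)" for \<mu>
    proof -
      have sets: "sets \<mu> = sets A"
        using that by (simp add: M_space_def)
      have fm: "f \<in> measurable \<mu> B"
        using Hom_ProbD(1)[OF f] by (simp add: measurable_cong_sets[OF sets refl])
      have "distr \<mu> E (compose (space A) g f) = distr \<mu> E (g \<circ> f)"
        using sets_eq_imp_space_eq[OF sets] by (intro distr_cong) (auto simp: compose_def)
      then show ?thesis
        by (simp add: distr_distr[OF Hom_ProbD(1)[OF g] fm])
    qed
    then have "transport_map Inr Inr (M_space A) (\<lambda>\<mu>. distr \<mu> E (compose (space A) g f)) =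
      transport_map Inr Inr (M_space A) (\<lambda>\<mu>. distr (distr \<mu> B f) E g)"
      by (intro transport_map_cong) auto
    then show "on_hom M_functor A E (Comp Prob A B E g f) =
        Comp CMet (on_obj M_functor A) (on_obj M_functor B) (on_obj M_functor E)
          (on_hom M_functor B E g) (on_hom M_functor A B f)"
      using distr_in_M_space[OF _ f]
      by (simp add: M_functor_def compose_transport_map) (simp add: Prob_def)
  qed
qed

theorem theorem2p18:
  shows "natural_isomorphism
    (Prob :: ('a measure, 'a \<Rightarrow> 'a) cat)
    (CMet :: ('a point emspace, 'a point \<Rightarrow> 'a point) cat)
    RV_functor M_functor \<rho>"
proof (rule natural_isomorphismI[OF functor_M])
  have \<rho>: "\<rho> \<Omega> = transport_map Inl Inr (RV_space \<Omega>) (integral_measure \<Omega>)" for \<Omega> :: "'a measure"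
    by (simp add: \<rho>_def integral_measure_def[abs_def])
  have fin: "finite_measure \<Omega>" if "\<Omega> \<in> Obj Prob" for \<Omega> :: "'a measure"
    using that by (simp add: Prob_def prob_space.finite_measure)
  {
    fix \<Omega> :: "'a measure" assume \<Omega>: "\<Omega> \<in> Obj Prob"
    show "on_obj RV_functor \<Omega> \<in> Obj CMet"
      using isometry_Obj_CMet[OF isometry_transport RV_space_in_CMet, of Inl \<Omega>]
      by (simp add: RV_functor_def)
    have "\<rho> \<Omega> \<in> extensional (points (transport Inl (RV_space \<Omega>)))"
      by (simp add: \<rho>_def transport_map_def transport_def)
    then show "isomorphism CMet (on_obj RV_functor \<Omega>) (on_obj M_functor \<Omega>) (\<rho> \<Omega>)"
      using isometry_transport_map[OF inj_Inl inj_Inr isometry_integral_measure[OF fin[OF \<Omega>]]]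
      by (simp add: RV_functor_def M_functor_def \<rho> isometry_isomorphism)
  next
    fix \<Omega>1 \<Omega>2 :: "'a measure" and g
    assume \<Omega>: "\<Omega>1 \<in> Obj Prob" "\<Omega>2 \<in> Obj Prob" and g: "g \<in> Hom Prob \<Omega>1 \<Omega>2"
    note ce = cond_exp_along[OF fin[OF \<Omega>(2)] _ g]
    show "on_hom RV_functor \<Omega>1 \<Omega>2 g \<in> Hom CMet (on_obj RV_functor \<Omega>1) (on_obj RV_functor \<Omega>2)"
      using cond_exp_along_contraction[OF \<Omega>[THEN fin] g] ce(1)
      by (simp add: RV_functor_def transport_map_in_CMet)
    have "transport_map Inl Inr (RV_space \<Omega>1) (\<lambda>X. integral_measure \<Omega>2 (cond_exp_along \<Omega>1 \<Omega>2 g X)) =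
      transport_map Inl Inr (RV_space \<Omega>1) (\<lambda>X. distr (integral_measure \<Omega>1 X) \<Omega>2 g)"
      by (intro transport_map_cong ce(2)) auto
    then show "Comp CMet (on_obj RV_functor \<Omega>1) (on_obj RV_functor \<Omega>2) (on_obj M_functor \<Omega>2)
        (\<rho> \<Omega>2) (on_hom RV_functor \<Omega>1 \<Omega>2 g) =
      Comp CMet (on_obj RV_functor \<Omega>1) (on_obj M_functor \<Omega>1) (on_obj M_functor \<Omega>2)
        (on_hom M_functor \<Omega>1 \<Omega>2 g) (\<rho> \<Omega>1)"
      using ce(1) isometry_in[OF isometry_integral_measure[OF fin[OF \<Omega>(1)]]]
      by (simp add: RV_functor_def M_functor_def \<rho> compose_transport_map)
  }
qed

end
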